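(* Let $\lambda$ be an infinite cardinal, let $\nu,\mu\le\lambda$ be cardinals with $\operatorname{cf}([\lambda]^\nu,\subseteq)\le\lambda$ (this holds in particular if $\nu=1$ or $\nu=\lambda$), let $\chi$ be a cardinal and let $p:[\lambda^+]^2\to\mu$ be a partition. If $\mathrm{pr}_1(\lambda^+,\lambda\circledast\lambda^+/\nu\circledast\lambda^+,\lambda,\chi)_p$ and $\mathrm{pr}_1(\lambda^+,\lambda\circledast\lambda^+,\lambda^+,\chi)$ both hold, then $\mathrm{pr}_1(\lambda^+,\lambda\circledast\lambda^+/\nu\circledast\lambda^+,\lambda^+,\chi)_p$ holds.
   Context: $[\kappa]^2$ denotes the set of pairs $(\alpha,\beta)$ with $\alpha<\beta<\kappa$; a partition is any function $p:[\kappa]^2\to\mu$. $[\lambda]^\nu$ is the set of subsets of $\lambda$ of cardinality $\nu$, and $\operatorname{cf}([\lambda]^\nu,\subseteq)$ is the least size of a family $\mathcal F\subseteq[\lambda]^\nu$ such that every member of $[\lambda]^\nu$ is contained in some member of $\mathcal F$. For an ordinal $\sigma$, $[\kappa]^\sigma$ is the set of subsets of $\kappa$ of order type $\sigma$; $a<b$ means every element of $a$ is below every element of $b$; $[\mathcal A]^{\nu'}$ is the set of subfamilies of $\mathcal A$ of cardinality $\nu'$. Given $p:[\kappa]^2\to\mu$, a coloring $c:[\kappa]^2\to\theta$ witnesses $\mathrm{pr}_1(\kappa,\nu\circledast\kappa/\nu'\circledast\kappa,\theta,\chi)_p$ iff for every ordinal $\sigma<\chi$ and every two families $\mathcal A,\mathcal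 B\subseteq[\kappa]^\sigma$, each pairwise disjoint, with $|\mathcal A|=\nu$ and $|\mathcal B|=\kappa$, there is $\mathcal A'\in[\mathcal A]^{\nu'}$ such that for every $\tau:\mu\to\theta$ there are $a\in\mathcal A'$ and $b\in\mathcal B$ with $a<b$ and $c(\alpha,\beta)=\tau(p(\alpha,\beta))$ for all $\alpha\in a,\beta\in b$. The principle asserts such $c$ exists. $\mathrm{pr}_1(\kappa,\nu\circledast\kappa,\theta,\chi)_p$ abbreviates the case $\nu'=\nu$, and omitting the subscript $p$ means $p$ is the constant partition (one cell, $\mu=1$), i.e., the requirement is that for every color $\gamma<\theta$ there are $a\in\mathcal A'$, $b\in\mathcal B$ with $a<b$ and $c(\alpha,\beta)=\gamma$ for all $\alpha\in a,\beta\in b$. *)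

theory Defs
  imports Main
begin

unbundle cardinal_syntax

text \<open>Ordinals/cardinals are represented by well-orders (library BNF_Cardinal_Order_Relation).
  The ordinal kappa is a well-order r; its elements are Field r, and alpha < beta means
  (alpha,beta) in r and alpha ~= beta.\<close>

definition ord_less :: "'k rel \<Rightarrow> 'k \<Rightarrow> 'k \<Rightarrow> bool" where
  "ord_less r x y \<longleftrightarrow> (x, y) \<in> r \<and> x \<noteq> y"

definition set_below :: "'k rel \<Rightarrow> 'k set \<Rightarrow> 'k set \<Rightarrow> bool" where
  "set_below r a b \<longleftrightarrow> (\<forall>x\<in>a. \<forall>y\<in>b. ord_less r x y)"

definition pairwise_disj :: "'a set set \<Rightarrow> bool" where
  "pairwise_disj F \<longleftrightarrow> (\<forall>a\<in>F. \<forall>b\<in>F. a \<noteq> b \<longrightarrow> a \<inter> b = {})"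

definition is_partition :: "'k rel \<Rightarrow> 'm set \<Rightarrow> ('k \<Rightarrow> 'k \<Rightarrow> 'm) \<Rightarrow> bool" where
  "is_partition r M p \<longleftrightarrow>
     (\<forall>x\<in>Field r. \<forall>y\<in>Field r. ord_less r x y \<longrightarrow> p x y \<in> M)"

text \<open>c witnesses pr_1(kappa, nu (*) kappa / nu' (*) kappa, theta, chi)_p, where
  kappa = r, nu, nu', chi are cardinals (card orders), theta = |Th|, mu = |M|.\<close>
definition pr1_witness ::
  "'k rel \<Rightarrow> 'n rel \<Rightarrow> 'n2 rel \<Rightarrow> 'c set \<Rightarrow> 'x rel \<Rightarrow> 'm set \<Rightarrow> ('k \<Rightarrow> 'k \<Rightarrow> 'm)
    \<Rightarrow> ('k \<Rightarrow> 'k \<Rightarrow> 'c) \<Rightarrow> bool" where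
  "pr1_witness r nu nu' Th chi M p c \<longleftrightarrow>
     (\<forall>x\<in>Field r. \<forall>y\<in>Field r. ord_less r x y \<longrightarrow> c x y \<in> Th) \<and>
     (\<forall>(\<sigma>::'k rel) (A::'k set set) (B::'k set set).
        Well_order \<sigma> \<and> \<sigma> <o chi \<and>
        (\<forall>a\<in>A \<union> B. a \<subseteq> Field r \<and> Restr r a =o \<sigma>) \<and>
        pairwise_disj A \<and> pairwise_disj B \<and> |A| =o nu \<and> |B| =o r \<longrightarrow>
        (\<exists>A'\<subseteq>A. |A'| =o nu' \<and>
           (\<forall>\<tau>. (\<forall>m\<in>M. \<tau> m \<in> Th) \<longrightarrow>
              (\<exists>a\<in>A'. \<exists>b\<in>B. set_below r a b \<and>
                 (\<forall>x\<in>a. \<forall>y\<in>b. c x y = \<tau> (p x y))))))"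

definition pr1 ::
  "'k rel \<Rightarrow> 'n rel \<Rightarrow> 'n2 rel \<Rightarrow> 'c set \<Rightarrow> 'x rel \<Rightarrow> 'm set \<Rightarrow> ('k \<Rightarrow> 'k \<Rightarrow> 'm) \<Rightarrow> bool" where
  "pr1 r nu nu' Th chi M p \<longleftrightarrow> (\<exists>c::'k \<Rightarrow> 'k \<Rightarrow> 'c. pr1_witness r nu nu' Th chi M p c)"

definition cf_subsets_le :: "'l rel \<Rightarrow> 'n rel \<Rightarrow> 'q rel \<Rightarrow> bool" where
  "cf_subsets_le lam nu kap \<longleftrightarrow>
     (\<exists>F. F \<subseteq> {X. X \<subseteq> Field lam \<and> |X| =o nu} \<and> |F| \<le>o kap \<and>
          (\<forall>Y. Y \<subseteq> Field lam \<and> |Y| =o nu \<longrightarrow> (\<exists>X\<in>F. Y \<subseteq> X)))"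

end

(* Let c0 and c1 witness the two hypotheses, let D be a set of lam ordinals below r, and for every
   g < r let e g map lam onto the ordinals up to g.  Reading c0 x y as a code of a pair (d, j) with
   d in D, the coloring is c x y = e (c1 d y) j.

   Given A and B and g < r, the strong property of c1 lets almost every b in B see the color g
   constantly from some d in D, so a single d serves r-many b.  Applying c0 to A and these b gives
   a subfamily of A of size nu that handles every tau bounded by g.  This subfamily depends on g, but
   it may be enlarged to a member of a cofinal family of size at most lam, so one member of that
   family handles unboundedly many g, and every tau is bounded. *)
theory Submission
  imports Defs
begin

unbundle cardinal_syntax

section \<open>Elimination and introduction rules for witnesses\<close>

lemma pr1_witnessD:
  fixes r s :: "'k rel"
  assumes "pr1_witness r nu nu' Th chi M p c" "Well_order s" "s <o chi"
    and "\<And>x. x \<in> A \<union> B \<Longrightarrow> x \<subseteq> Field r \<and> Restr r x =o s"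
    and "pairwise_disj A" "pairwise_disj B" "|A| =o nu" "|B| =o r"
  obtains A' where "A' \<subseteq> A" "|A'| =o nu'"
    "\<forall>\<tau>. (\<forall>m\<in>M. \<tau> m \<in> Th) \<longrightarrow>
      (\<exists>a\<in>A'. \<exists>b\<in>B. set_below r a b \<and> (\<forall>x\<in>a. \<forall>y\<in>b. c x y = \<tau> (p x y)))"
proof -
  have hyps: "Well_order s \<and> s <o chi \<and> (\<forall>x\<in>A \<union> B. x \<subseteq> Field r \<and> Restr r x =o s) \<and>
      pairwise_disj A \<and> pairwise_disj B \<and> |A| =o nu \<and> |B| =o r"
    by (intro conjI ballI assms(2,3,5-8)) (use assms(4) in simp_all)
  note w = assms(1)[unfolded pr1_witness_def, THEN conjunct2, rule_format, OF hyps]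
  from w obtain A' where "A' \<subseteq> A \<and> |A'| =o nu' \<and> (\<forall>\<tau>. (\<forall>m\<in>M. \<tau> m \<in> Th) \<longrightarrow>
      (\<exists>a\<in>A'. \<exists>b\<in>B. set_below r a b \<and> (\<forall>x\<in>a. \<forall>y\<in>b. c x y = \<tau> (p x y))))" ..
  then show thesis using that[of A'] by blast
qed

lemma pr1_witnessI:
  fixes r :: "'k rel"
  assumes "\<And>x y. x \<in> Field r \<Longrightarrow> y \<in> Field r \<Longrightarrow> ord_less r x y \<Longrightarrow> c x y \<in> Th"
    and "\<And>(s :: 'k rel) A B. Well_order s \<Longrightarrow> s <o chi \<Longrightarrow>
      (\<And>x. x \<in> A \<union> B \<Longrightarrow> x \<subseteq> Field r \<and> Restr r x =o s) \<Longrightarrow>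
      pairwise_disj A \<Longrightarrow> pairwise_disj B \<Longrightarrow> |A| =o nu \<Longrightarrow> |B| =o r \<Longrightarrow>
      \<exists>A'\<subseteq>A. |A'| =o nu' \<and> (\<forall>\<tau>. (\<forall>m\<in>M. \<tau> m \<in> Th) \<longrightarrow>
        (\<exists>a\<in>A'. \<exists>b\<in>B. set_below r a b \<and> (\<forall>x\<in>a. \<forall>y\<in>b. c x y = \<tau> (p x y))))"
  shows "pr1_witness r nu nu' Th chi M p c"
  unfolding pr1_witness_def
proof (intro conjI allI impI)
  show "\<forall>x\<in>Field r. \<forall>y\<in>Field r. ord_less r x y \<longrightarrow> c x y \<in> Th" using assms(1) by blast
qed (elim conjE, rule assms(2), assumption+, erule (1) bspec, assumption+)

lemma card_of_image_inj_on: "inj_on f X \<Longrightarrow> |f ` X| =o |X|"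
  by (rule ordIso_symmetric[OF card_of_ordIsoI[OF inj_on_imp_bij_betw]])

section \<open>Small sets and the regularity of a successor cardinal\<close>

locale card_successor =
  fixes lam :: "'l rel" and r :: "'k rel"
  assumes Card_lam: "Card_order lam" and infinite_lam: "\<not> finite (Field lam)"
    and Card_r: "Card_order r" and r_suc: "r =o cardSuc lam"
begin

lemma Well_order_r: "Well_order r"
  using Card_r by (simp add: card_order_on_def)

lemma r_refl: "x \<in> Field r \<Longrightarrow> (x, x) \<in> r"
  using Well_order_r by (auto simp: order_on_defs dest: refl_onD)

lemma r_trans: "(x, y) \<in> r \<Longrightarrow> (y, z) \<in> r \<Longrightarrow> (x, z) \<in> r"
  using Well_order_r by (auto simp: order_on_defs dest: transD)

lemma r_antisym: "(x, y) \<in> r \<Longrightarrow> (y, x) \<in> r \<Longrightarrow> x = y"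
  using Well_order_r by (auto simp: order_on_defs dest: antisymD)

lemma r_total: "x \<in> Field r \<Longrightarrow> y \<in> Field r \<Longrightarrow> (x, y) \<in> r \<or> (y, x) \<in> r"
  using Well_order_r r_refl by (cases "x = y") (auto simp: order_on_defs total_on_def)

lemma lam_less_r: "lam <o r"
  using cardSuc_greater[OF Card_lam] ordIso_symmetric[OF r_suc] ordLess_ordIso_trans by blast

lemma ordLess_r_imp_ordLeq_lam: "|X| <o r \<Longrightarrow> |X| \<le>o lam"
  using cardSuc_ordLeq_ordLess[OF Card_lam card_of_Card_order] r_suc ordLess_ordIso_trans by blast

lemma finite_ordLeq_lam: "finite X \<Longrightarrow> |X| \<le>o lam"
  using finite_ordLess_infinite[of "|X|" lam] infinite_lam Card_lam
    card_of_Well_order[of X] ordLess_imp_ordLeq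
  unfolding card_order_on_def Field_card_of by blast

lemma ordLeq_lam_subset: "X \<subseteq> Y \<Longrightarrow> |Y| \<le>o lam \<Longrightarrow> |X| \<le>o lam"
  by (rule ordLeq_transitive[OF card_of_mono1])

lemma not_ordLeq_lam_if_ordIso_r: "|X| =o r \<Longrightarrow> \<not> |X| \<le>o lam"
  using lam_less_r by (meson not_ordLess_ordIso ordIso_symmetric ordLeq_ordLess_trans)

text \<open>No cardinal lies strictly between \<open>lam\<close> and \<open>r\<close>. The negation
  of \<open>|Y| \<le>o lam\<close> is the working form of largeness; this lemma turns it into the
  size \<open>r\<close> that \<open>pr1_witness\<close> asks of its second family.\<close>

lemma ordIso_r_if_not_ordLeq_lam:
  assumes "\<not> |Y| \<le>o lam" "Y \<subseteq> B" "|B| =o r"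
  shows "|Y| =o r"
proof -
  have "|Y| \<le>o r" using assms(2,3) card_of_mono1 ordLeq_ordIso_trans by blast
  then show ?thesis using assms(1) ordLess_r_imp_ordLeq_lam ordLeq_iff_ordLess_or_ordIso by blast
qed

lemma card_UN_ordLeq_lam:
  assumes "|I| \<le>o lam" "\<And>i. i \<in> I \<Longrightarrow> |S i| \<le>o lam"
  shows "|\<Union>i\<in>I. S i| \<le>o lam"
  using card_of_UNION_ordLeq_infinite_Field[OF infinite_lam Card_lam assms(1)] assms(2) by blast

text \<open>This is the regularity of \<open>r\<close>: at most \<open>lam\<close> sets of size at
  most \<open>lam\<close> have a union of size at most \<open>lam\<close>. Since \<open>P\<close> is
  a relation, a point may have several indices and none has to be chosen.\<close>

lemma pigeonhole:
  assumes "\<not> |X| \<le>o lam" "|I| \<le>o lam" "\<And>x. x \<in> X \<Longrightarrow> \<exists>i\<in>I. P i x"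
  obtains i where "i \<in> I" "\<not> |{x \<in> X. P i x}| \<le>o lam"
proof (rule ccontr)
  assume "\<not> thesis"
  then have "|\<Union>i\<in>I. {x \<in> X. P i x}| \<le>o lam"
    using that by (intro card_UN_ordLeq_lam assms(2)) blast
  moreover have "X \<subseteq> (\<Union>i\<in>I. {x \<in> X. P i x})" using assms(3) by blast
  ultimately show False using assms(1) ordLeq_lam_subset by blast
qed

text \<open>A proper initial segment of a cardinal is smaller than it, here of size at most
  \<open>lam\<close>. The point \<open>x\<close> itself is added through a union indexed by the two
  Booleans.\<close>

lemma card_under_ordLeq_lam:
  assumes "x \<in> Field r"
  shows "|{y. (y, x) \<in> r}| \<le>o lam"
proof -
  have "|underS r x| \<le>o lam"
    using card_of_underS[OF Card_r assms] by (rule ordLess_r_imp_ordLeq_lam)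
  moreover have "{y. (y, x) \<in> r} \<subseteq> (\<Union>i\<in>UNIV. if i then underS r x else {x})"
    by (auto simp: underS_def)
  moreover have "|UNIV :: bool set| \<le>o lam" "|{x}| \<le>o lam"
    by (simp_all add: finite_ordLeq_lam)
  ultimately have "|\<Union>i\<in>UNIV. if i then underS r x else {x}| \<le>o lam"
    by (intro card_UN_ordLeq_lam) auto
  then show ?thesis
    using \<open>{y. (y, x) \<in> r} \<subseteq> _\<close> ordLeq_lam_subset by blast
qed

lemma not_ordLeq_lam_Field: "\<not> |Field r| \<le>o lam"
  using card_of_Field_ordIso[OF Card_r] by (rule not_ordLeq_lam_if_ordIso_r)

text \<open>If \<open>X\<close> had no bound, totality of \<open>r\<close> would make the closed
  initial segments at the points of \<open>X\<close> cover \<open>Field r\<close>, which is too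
  large for that.\<close>

lemma bounded_if_ordLeq_lam:
  assumes "X \<subseteq> Field r" "|X| \<le>o lam"
  obtains g where "g \<in> Field r" "\<And>x. x \<in> X \<Longrightarrow> (x, g) \<in> r"
proof (rule ccontr)
  assume "\<not> thesis"
  then have "\<forall>g\<in>Field r. \<exists>x\<in>X. (g, x) \<in> r"
    using that assms(1) r_total by blast
  then have "Field r \<subseteq> (\<Union>x\<in>X. {y. (y, x) \<in> r})" by blast
  moreover have "|\<Union>x\<in>X. {y. (y, x) \<in> r}| \<le>o lam"
    by (rule card_UN_ordLeq_lam[OF assms(2) card_under_ordLeq_lam]) (use assms(1) in blast)
  ultimately have "|Field r| \<le>o lam" by (rule ordLeq_lam_subset)
  then show False using not_ordLeq_lam_Field by contradiction
qed

text \<open>A point of \<open>S\<close> lies in at most one member of a disjoint family, so choosing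
  a point of \<open>b \<inter> S\<close> for each \<open>b\<close> is injective.\<close>

lemma card_meeting_ordLeq_lam:
  assumes "pairwise_disj B" "|S| \<le>o lam"
  shows "|{b \<in> B. b \<inter> S \<noteq> {}}| \<le>o lam"
proof -
  define f where "f b = (SOME x. x \<in> b \<inter> S)" for b
  have f: "f b \<in> b \<inter> S" if "b \<in> B" "b \<inter> S \<noteq> {}" for b
  proof -
    have "\<exists>x. x \<in> b \<inter> S" using that(2) by blast
    then show ?thesis unfolding f_def by (rule someI_ex)
  qed
  have "inj_on f {b \<in> B. b \<inter> S \<noteq> {}}"
  proof (rule inj_onI)
    fix b b'
    assume bb': "b \<in> {b \<in> B. b \<inter> S \<noteq> {}}" "b' \<in> {b \<in> B. b \<inter> S \<noteq> {}}" "f b = f b'"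
    then have "f b \<in> b \<inter> b'" using f[of b] f[of b'] by simp
    then show "b = b'" using bb'(1,2) assms(1) unfolding pairwise_disj_def by blast
  qed
  moreover have "f ` {b \<in> B. b \<inter> S \<noteq> {}} \<subseteq> S" using f by blast
  ultimately have "|{b \<in> B. b \<inter> S \<noteq> {}}| \<le>o |S|"
    by (intro card_of_ordLeq[THEN iffD1] exI[of _ f] conjI)
  then show ?thesis using assms(2) by (rule ordLeq_transitive)
qed

section \<open>Order types of subsets of \<open>r\<close>\<close>

lemma Field_Restr_r: "b \<subseteq> Field r \<Longrightarrow> Field (Restr r b) = b"
  using r_refl unfolding Field_def by blast

lemma obtain_minimum:
  assumes "b \<subseteq> Field r" "b \<noteq> {}"
  obtains m where "m \<in> b" "\<And>x. x \<in> b \<Longrightarrow> (m, x) \<in> r"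
proof -
  interpret wo_rel r using Well_order_r by (simp add: wo_rel_def)
  show thesis using minim_in[OF assms] minim_least[OF assms(1)] that by blast
qed

text \<open>The map sending \<open>d\<close> to \<open>m\<close> and fixing every other point is an
  isomorphism: \<open>d\<close> is below all of \<open>b\<close>, just as \<open>m\<close> is least
  in \<open>b\<close>.\<close>

lemma replace_minimum_ordIso:
  assumes "b \<subseteq> Field r" "m \<in> b" "\<And>x. x \<in> b \<Longrightarrow> (m, x) \<in> r"
    and "d \<in> Field r" "\<And>x. x \<in> b \<Longrightarrow> ord_less r d x"
  shows "Restr r (insert d (b - {m})) =o Restr r b"
proof -
  let ?a = "insert d (b - {m})"
  let ?f = "\<lambda>x. if x = d then m else x"
  have sub: "?a \<subseteq> Field r" using assms by auto
  have d: "d \<notin> b" using assms(5) unfolding ord_less_def by blast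
  have dm: "(d, x) \<in> r" "(x, d) \<notin> r" if "x \<in> b" for x
    using that assms(5) r_antisym unfolding ord_less_def by blast+
  have "bij_betw ?f ?a b" unfolding bij_betw_def inj_on_def using d assms(2) by auto
  moreover have "((x, y) \<in> Restr r ?a) = ((?f x, ?f y) \<in> Restr r b)" if "x \<in> ?a" "y \<in> ?a" for x y
  proof -
    have *: "(x, m) \<in> r \<longleftrightarrow> x = m" if "x \<in> b" for x
      using that assms(2,3) r_antisym by blast
    show ?thesis
      using that dm * assms(2,3) r_refl[OF assms(4)] d by (cases "x = d"; cases "y = d") auto
  qed
  ultimately have "iso (Restr r ?a) (Restr r b) ?f"
    unfolding iso_iff2 Field_Restr_r[OF sub] Field_Restr_r[OF assms(1)] by blast
  moreover have "Well_order (Restr r ?a)" "Well_order (Restr r b)"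
    using Well_order_Restr[OF Well_order_r] by blast+
  ultimately show ?thesis unfolding ordIso_def by blast
qed

text \<open>Only the empty set has the order type of the empty set, so a family of one type
  containing it has a single member. This excludes type 0 and lets every member of a large family
  have a minimum.\<close>

lemma not_empty_in_family:
  assumes "\<And>b. b \<in> B \<Longrightarrow> b \<subseteq> Field r \<and> Restr r b =o s" "\<not> |B| \<le>o lam"
  shows "{} \<notin> B"
proof
  assume "{} \<in> B"
  have "b = {}" if "b \<in> B" for b
  proof -
    have "Restr r b =o Restr r {}"
      using ordIso_transitive[OF conjunct2[OF assms(1)[OF that]] ordIso_symmetric[OF conjunct2]]
        assms(1)[OF \<open>{} \<in> B\<close>] .
    then obtain f where "bij_betw f (Field (Restr r b)) (Field (Restr r {}))"
      unfolding ordIso_def iso_def by auto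
    then show ?thesis
      using Field_Restr_r[of b] Field_Restr_r[of "{}"] assms(1)[OF that]
      by (metis bij_betw_empty2 empty_subsetI)
  qed
  then have "B \<subseteq> {{}}" by blast
  then have "finite B" using finite_subset by blast
  then have "|B| \<le>o lam" by (rule finite_ordLeq_lam)
  then show False using assms(2) by simp
qed

lemma obtain_subset_ordIso_lam:
  assumes "\<not> |B| \<le>o lam"
  obtains S where "S \<subseteq> B" "|S| =o lam"
proof -
  have "lam \<le>o |B|"
    using assms Card_lam card_of_Well_order[of B] ordLeq_total[of lam "|B|"]
    by (auto simp: card_order_on_def)
  then obtain f where f: "inj_on f (Field lam)" "f ` Field lam \<subseteq> B"
    using card_of_ordLeq[of "Field lam" B] card_of_Field_ordIso[OF Card_lam] ordIso_ordLeq_trans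
    by blast
  show thesis
    by (rule that[OF f(2) ordIso_transitive[OF card_of_image_inj_on[OF f(1)]
          card_of_Field_ordIso[OF Card_lam]]])
qed

section \<open>Seeing a prescribed color from a set of \<open>lam\<close> points\<close>

text \<open>The families in the definition of \<open>pr\<^sub>1\<close> consist of sets of one order type, so the points of
  \<open>D\<close> cannot be used as singletons: each is made the least element of a set of the right type, by
  letting it replace the minimum of a member of \<open>B\<close> lying above \<open>D\<close>.\<close>

lemma almost_all_see_color:
  fixes c1 :: "'k \<Rightarrow> 'k \<Rightarrow> 'k" and s :: "'k rel"
  assumes c1: "pr1_witness r lam lam (Field r) chi {()} (\<lambda>_ _. ()) c1"
    and D: "D \<subseteq> Field r" "|D| =o lam"
    and s: "Well_order s" "s <o chi"
    and B: "\<And>b. b \<in> B \<Longrightarrow> b \<subseteq> Field r \<and> Restr r b =o s" "pairwise_disj B" "|B| =o r"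
    and g: "g \<in> Field r"
  shows "|{b \<in> B. \<not> (\<exists>d\<in>D. \<forall>y\<in>b. c1 d y = g)}| \<le>o lam"
proof (rule ccontr)
  define B' where "B' = {b \<in> B. \<not> (\<exists>d\<in>D. \<forall>y\<in>b. c1 d y = g)}"
  assume "\<not> ?thesis"
  then have large: "\<not> |B'| \<le>o lam" by (simp add: B'_def)
  have B'_sub: "B' \<subseteq> B" by (auto simp: B'_def)
  have disj: "pairwise_disj B'" using B(2) B'_sub by (auto simp: pairwise_disj_def)
  have card_B': "|B'| =o r" using ordIso_r_if_not_ordLeq_lam[OF large B'_sub B(3)] .
  have "|D| \<le>o lam" using D(2) ordIso_imp_ordLeq by blast
  then obtain t where t: "t \<in> Field r" "\<And>d. d \<in> D \<Longrightarrow> (d, t) \<in> r"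
    using bounded_if_ordLeq_lam D(1) by blast
  let ?T = "{y. (y, t) \<in> r}"
  \<comment> \<open>Only \<open>lam\<close> members of the disjoint family \<open>B'\<close> can
    meet the segment up to \<open>t\<close>, so a large part of \<open>B'\<close> lies entirely
    above \<open>t\<close> and hence above \<open>D\<close>.\<close>
  have "\<not> |{b \<in> B'. b \<inter> ?T = {}}| \<le>o lam"
  proof
    assume *: "|{b \<in> B'. b \<inter> ?T = {}}| \<le>o lam"
    obtain P where "P \<in> {True, False}" "\<not> |{b \<in> B'. (b \<inter> ?T = {}) = P}| \<le>o lam"
    proof (rule pigeonhole[OF large, of "{True, False}" "\<lambda>P b. (b \<inter> ?T = {}) = P"])
      show "|{True, False}| \<le>o lam"
        by (simp add: finite_ordLeq_lam)
    qed auto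
    then show False
      using * card_meeting_ordLeq_lam[OF disj card_under_ordLeq_lam[OF t(1)]] by (cases P) auto
  qed
  then obtain S where S: "S \<subseteq> {b \<in> B'. b \<inter> ?T = {}}" "|S| =o lam"
    by (rule obtain_subset_ordIso_lam)
  obtain h where h: "bij_betw h D S"
    using ordIso_transitive[OF D(2) ordIso_symmetric[OF S(2)]] card_of_ordIso by blast
  have hS: "h d \<in> B" "h d \<inter> ?T = {}" "h d \<subseteq> Field r" if "d \<in> D" for d
    using that h S(1) B'_sub B(1) unfolding bij_betw_def by blast+
  \<comment> \<open>The bound \<open>t\<close> is common to all of \<open>D\<close>, so this holds
    for two different points \<open>d\<close> and \<open>d'\<close> as well; disjointness of the
    sets \<open>a d\<close> relies on that.\<close>
  have above: "ord_less r d x" if "d \<in> D" "d' \<in> D" "x \<in> h d'" for d d' x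
  proof -
    have "(t, x) \<in> r" "(x, t) \<notin> r" using hS[OF that(2)] that(3) t(1) r_total by blast+
    then show ?thesis using t(2)[OF that(1)] r_trans unfolding ord_less_def by blast
  qed
  have "\<exists>m. m \<in> h d \<and> (\<forall>x\<in>h d. (m, x) \<in> r)" if "d \<in> D" for d
    using obtain_minimum[OF hS(3)[OF that]] hS(1)[OF that]
      not_empty_in_family[OF B(1) not_ordLeq_lam_if_ordIso_r[OF B(3)]] by metis
  then obtain m where m: "\<And>d. d \<in> D \<Longrightarrow> m d \<in> h d \<and> (\<forall>x\<in>h d. (m d, x) \<in> r)" by metis
  \<comment> \<open>Each \<open>d\<close> takes the place of the minimum of its own set
    \<open>h d\<close>, which keeps the order type \<open>s\<close>. The sets \<open>a d\<close> are
    disjoint because the \<open>h d\<close> are, and no point of \<open>D\<close> lies in any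
    \<open>h d'\<close>.\<close>
  define a where "a d = insert d (h d - {m d})" for d
  have notin: "d \<notin> h d'" if "d \<in> D" "d' \<in> D" for d d'
    using above[OF that] unfolding ord_less_def by blast
  have disj_a: "a d \<inter> a d' = {}" if "d \<in> D" "d' \<in> D" "d \<noteq> d'" for d d'
  proof -
    have "h d \<noteq> h d'" using h that unfolding bij_betw_def inj_on_def by blast
    then have "h d \<inter> h d' = {}" using hS(1) that B(2) unfolding pairwise_disj_def by blast
    then show ?thesis using notin that unfolding a_def by blast
  qed
  have "inj_on a D" using disj_a unfolding inj_on_def a_def by blast
  then have card_a: "|a ` D| =o lam"
    by (rule ordIso_transitive[OF card_of_image_inj_on D(2)])
  have a_type: "a d \<subseteq> Field r \<and> Restr r (a d) =o s" if "d \<in> D" for d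
  proof
    show "a d \<subseteq> Field r" using that D(1) hS(3) unfolding a_def by blast
    have "Restr r (a d) =o Restr r (h d)"
      unfolding a_def using that D(1) hS(3) m above by (intro replace_minimum_ordIso) auto
    then show "Restr r (a d) =o s" 
      using conjunct2[OF B(1)[OF hS(1)[OF that]]] by (rule ordIso_transitive)
  qed
  have disj_image: "pairwise_disj (a ` D)" using disj_a unfolding pairwise_disj_def by blast
  have types: "x \<subseteq> Field r \<and> Restr r x =o s" if "x \<in> a ` D \<union> B'" for x
    using that
  proof
    assume "x \<in> a ` D"
    then show ?thesis using a_type by blast
  next
    assume "x \<in> B'"
    then show ?thesis using B(1) B'_sub by blast
  qed
  obtain A' where A': "A' \<subseteq> a ` D" "|A'| =o lam"
    "\<forall>\<tau>. (\<forall>u\<in>{()}. \<tau> u \<in> Field r) \<longrightarrow>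
      (\<exists>x\<in>A'. \<exists>b\<in>B'. set_below r x b \<and> (\<forall>u\<in>x. \<forall>y\<in>b. c1 u y = \<tau> ()))"
    by (rule pr1_witnessD[OF c1 s types disj_image disj card_a card_B'])
  \<comment> \<open>The constant choice \<open>g\<close> yields some \<open>a d\<close> and some
    \<open>b\<close> in \<open>B'\<close> with color \<open>g\<close> throughout. As
    \<open>d\<close> is in \<open>a d\<close>, it sees \<open>g\<close> on all of \<open>b\<close>,
    against the definition of \<open>B'\<close>.\<close>
  from A'(3)[THEN spec, of "\<lambda>_. g"] g obtain x b where xb: "x \<in> A'" "b \<in> B'" "\<forall>u\<in>x. \<forall>y\<in>b. c1 u y = g"
    by blast
  then obtain d where "d \<in> D" "x = a d" using A'(1) by blast
  then have "\<exists>d\<in>D. \<forall>y\<in>b. c1 d y = g" using xb(3) unfolding a_def by blast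
  then show False using xb(2) unfolding B'_def by blast
qed

section \<open>The stretched coloring\<close>

lemma pr1_stretch_colors:
  fixes nu :: "'n rel" and chi :: "'x rel" and M :: "'m set" and p :: "'k \<Rightarrow> 'k \<Rightarrow> 'm"
  assumes M: "|M| \<le>o lam" and cf: "cf_subsets_le lam nu lam" and p: "is_partition r M p"
    and pr0: "pr1 r lam nu (Field lam) chi M p"
    and pr1: "pr1 r lam lam (Field r) chi {()} (\<lambda>_ _. ())"
  shows "pr1 r lam nu (Field r) chi M p"
proof -
  obtain c0 where c0: "pr1_witness r lam nu (Field lam) chi M p c0"
    using pr0 unfolding pr1_def ..
  obtain c1 where c1: "pr1_witness r lam lam (Field r) chi {()} (\<lambda>_ _. ()) c1"
    using pr1 unfolding pr1_def ..
  obtain D where D: "D \<subseteq> Field r" "|D| =o lam"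
    by (rule obtain_subset_ordIso_lam[OF not_ordLeq_lam_Field])
  have "|D \<times> Field lam| \<le>o lam"
    using D(2) card_of_Field_ordIso[OF Card_lam]
    by (intro card_of_Times_ordLeq_infinite_Field[OF infinite_lam _ _ Card_lam] ordIso_imp_ordLeq)
  then have "|D \<times> Field lam| \<le>o |Field lam|"
    using card_of_Field_ordIso[OF Card_lam] ordIso_symmetric ordLeq_ordIso_trans by blast
  then obtain code where code: "inj_on code (D \<times> Field lam)" "code ` (D \<times> Field lam) \<subseteq> Field lam"
    using card_of_ordLeq by metis
  \<comment> \<open>\<open>code\<close> is only injective, so \<open>dec\<close> is meaningful on
    its range alone; the same holds for \<open>e g\<close> and the range of \<open>f g\<close>
    below.\<close>
  define dec where "dec = the_inv_into (D \<times> Field lam) code"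
  have dec: "dec (code (d, j)) = (d, j)" if "d \<in> D" "j \<in> Field lam" for d j
    unfolding dec_def using the_inv_into_f_f[OF code(1)] that by simp
  have "\<exists>f. inj_on f {y. (y, g) \<in> r} \<and> f ` {y. (y, g) \<in> r} \<subseteq> Field lam" if "g \<in> Field r" for g
    using card_of_ordLeq[of "{y. (y, g) \<in> r}" "Field lam"] card_under_ordLeq_lam[OF that]
      ordIso_symmetric[OF card_of_Field_ordIso[OF Card_lam]] ordLeq_ordIso_trans by metis
  then obtain f where f: "\<And>g. g \<in> Field r \<Longrightarrow>
      inj_on (f g) {y. (y, g) \<in> r} \<and> f g ` {y. (y, g) \<in> r} \<subseteq> Field lam"
    by metis
  define e where "e g = the_inv_into {y. (y, g) \<in> r} (f g)" for g
  have e: "e g (f g y) = y" if "g \<in> Field r" "(y, g) \<in> r" for g y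
    unfolding e_def using the_inv_into_f_f[of "f g"] f that by blast
  \<comment> \<open>Outside the ranges of \<open>code\<close> and \<open>f g\<close> the decoded
    \<open>z\<close> is arbitrary. The default \<open>x\<close> keeps every color in
    \<open>Field r\<close>.\<close>
  define c where "c x y = (let (d, j) = dec (c0 x y); z = e (c1 d y) j
      in if z \<in> Field r then z else x)" for x y
  show ?thesis
    unfolding pr1_def
  proof (intro exI[of _ c] pr1_witnessI)
    show "c x y \<in> Field r" if "x \<in> Field r" for x y
      using that by (simp add: c_def Let_def split: prod.split)
  next
    fix s :: "'k rel" and A B
    assume s: "Well_order s" "s <o chi"
      and AB: "\<And>a. a \<in> A \<union> B \<Longrightarrow> a \<subseteq> Field r \<and> Restr r a =o s"
      and disj: "pairwise_disj A" "pairwise_disj B" and card: "|A| =o lam" "|B| =o r"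
    \<comment> \<open>Bounding \<open>\<tau>\<close> by \<open>g\<close> lets the single map
      \<open>e g\<close> decode all its values. The property passes to larger \<open>X\<close>, and
      a family that works for \<open>g\<close> handles all \<open>\<tau>\<close> with a bound below
      \<open>g\<close>.\<close>
    define works where "works g X \<longleftrightarrow> (\<forall>\<tau>. (\<forall>m\<in>M. (\<tau> m, g) \<in> r) \<longrightarrow>
        (\<exists>a\<in>X. \<exists>b\<in>B. set_below r a b \<and> (\<forall>x\<in>a. \<forall>y\<in>b. c x y = \<tau> (p x y))))" for g X
    have works_mono: "works g Y" if works: "works g X" and XY: "X \<subseteq> Y" for g X Y
      unfolding works_def
    proof (intro allI impI)
      fix \<tau> assume "\<forall>m\<in>M. (\<tau> m, g) \<in> r"
      then have "\<exists>a\<in>X. \<exists>b\<in>B. set_below r a b \<and> (\<forall>x\<in>a. \<forall>y\<in>b. c x y = \<tau> (p x y))"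
        using works unfolding works_def by simp
      then show "\<exists>a\<in>Y. \<exists>b\<in>B. set_below r a b \<and> (\<forall>x\<in>a. \<forall>y\<in>b. c x y = \<tau> (p x y))"
        by (rule bexE) (use XY in blast)
    qed
    obtain F0 where "F0 \<subseteq> {X. X \<subseteq> Field lam \<and> |X| =o nu} \<and> |F0| \<le>o lam \<and>
        (\<forall>Y. Y \<subseteq> Field lam \<and> |Y| =o nu \<longrightarrow> (\<exists>X\<in>F0. Y \<subseteq> X))"
      using cf unfolding cf_subsets_le_def ..
    then have F0: "F0 \<subseteq> {X. X \<subseteq> Field lam \<and> |X| =o nu}" "|F0| \<le>o lam"
      "\<And>Y. Y \<subseteq> Field lam \<Longrightarrow> |Y| =o nu \<Longrightarrow> \<exists>X\<in>F0. Y \<subseteq> X"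
      by simp_all
    have "|Field lam| =o |A|"
      using card_of_Field_ordIso[OF Card_lam] ordIso_symmetric[OF card(1)]
      by (rule ordIso_transitive)
    then obtain h where h: "bij_betw h (Field lam) A" using card_of_ordIso by blast
    have card_image: "|h ` X| =o |X|" if "X \<subseteq> Field lam" for X
      using h that by (intro card_of_image_inj_on) (auto simp: bij_betw_def intro: inj_on_subset)
    \<comment> \<open>The cofinal family lives on \<open>Field lam\<close>; the bijection
      \<open>h\<close> carries it to \<open>A\<close>, keeping sizes and inclusions.\<close>
    define F where "F = (`) h ` F0"
    have F_le: "|F| \<le>o lam"
      unfolding F_def by (rule ordLeq_transitive[OF card_of_image F0(2)])
    have F_mem: "X \<subseteq> A \<and> |X| =o nu" if X: "X \<in> F" for X
    proof -
      obtain Z where Z: "Z \<subseteq> Field lam" "|Z| =o nu" "X = h ` Z"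
        using X F0(1) unfolding F_def by blast
      then show ?thesis
        using h ordIso_transitive[OF card_image[OF Z(1)] Z(2)] unfolding bij_betw_def by blast
    qed
    have F_cof: "\<exists>X\<in>F. Y \<subseteq> X" if Y: "Y \<subseteq> A" "|Y| =o nu" for Y
    proof -
      obtain Z where Z: "Z \<subseteq> Field lam" "Y = h ` Z"
        using Y(1) h unfolding bij_betw_def by (metis subset_image_iff)
      have "|Z| =o nu"
        using ordIso_transitive[OF ordIso_symmetric[OF card_image[OF Z(1)]]] Y(2) Z(2) by simp
      then show ?thesis using F0(3)[OF Z(1)] Z(2) unfolding F_def by blast
    qed
    have some_works: "\<exists>X\<in>F. works g X" if g: "g \<in> Field r" for g
    proof -
      let ?sees = "\<lambda>d b. \<forall>y\<in>b. c1 d y = g"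
      have bad: "|{b \<in> B. \<not> (\<exists>d\<in>D. ?sees d b)}| \<le>o lam"
        using almost_all_see_color[OF c1 D s _ disj(2) card(2) g] AB by blast
      \<comment> \<open>Otherwise \<open>B\<close> would be the union of \<open>lam\<close> small
        sets, one for each \<open>d\<close>, and the small set of members that see \<open>g\<close>
        from no \<open>d\<close>.\<close>
      obtain d where d: "d \<in> D" "\<not> |{b \<in> B. ?sees d b}| \<le>o lam"
      proof (rule ccontr)
        assume "\<not> thesis"
        then have "|\<Union>d\<in>D. {b \<in> B. ?sees d b}| \<le>o lam"
          using that D(2) ordIso_imp_ordLeq by (intro card_UN_ordLeq_lam) blast+
        then have "|(\<Union>d\<in>D. {b \<in> B. ?sees d b}) \<union> {b \<in> B. \<not> (\<exists>d\<in>D. ?sees d b)}| \<le>o lam"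
          using bad by (intro card_of_Un_ordLeq_infinite_Field[OF infinite_lam _ _ Card_lam])
        moreover have "B \<subseteq> (\<Union>d\<in>D. {b \<in> B. ?sees d b}) \<union> {b \<in> B. \<not> (\<exists>d\<in>D. ?sees d b)}" by blast
        ultimately have "|B| \<le>o lam" using ordLeq_lam_subset by blast
        then show False using not_ordLeq_lam_if_ordIso_r[OF card(2)] by blast
      qed
      define B' where "B' = {b \<in> B. ?sees d b}"
      have "B' \<subseteq> B" by (auto simp: B'_def)
      have disj': "pairwise_disj B'"
        using disj(2) \<open>B' \<subseteq> B\<close> unfolding pairwise_disj_def by blast
      have card': "|B'| =o r"
        using ordIso_r_if_not_ordLeq_lam[OF d(2) _ card(2)] unfolding B'_def by blast
      have types: "x \<subseteq> Field r \<and> Restr r x =o s" if "x \<in> A \<union> B'" for x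
        using AB that \<open>B' \<subseteq> B\<close> by blast
      obtain A' where A': "A' \<subseteq> A" "|A'| =o nu"
        "\<forall>\<tau>. (\<forall>m\<in>M. \<tau> m \<in> Field lam) \<longrightarrow>
          (\<exists>a\<in>A'. \<exists>b\<in>B'. set_below r a b \<and> (\<forall>x\<in>a. \<forall>y\<in>b. c0 x y = \<tau> (p x y)))"
        by (rule pr1_witnessD[OF c0 s types disj(1) disj' card(1) card'])
      have "works g A'"
        unfolding works_def
      proof (intro allI impI)
        fix \<tau> assume \<tau>: "\<forall>m\<in>M. (\<tau> m, g) \<in> r"
        \<comment> \<open>For fixed \<open>d\<close> and \<open>g\<close>, the function taking
          \<open>m\<close> to \<open>code (d, f g (\<tau> m))\<close> has values in
          \<open>Field lam\<close>, so \<open>c0\<close> can realize it. The subfamily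
          \<open>A'\<close> was obtained before \<open>\<tau>\<close> was given.\<close>
        have fl: "f g (\<tau> m) \<in> Field lam" if "m \<in> M" for m using f[OF g] \<tau> that by blast
        then have "\<forall>m\<in>M. code (d, f g (\<tau> m)) \<in> Field lam"
          using code(2) d(1) by blast
        then obtain a b where ab: "a \<in> A'" "b \<in> B'" "set_below r a b"
          "\<forall>x\<in>a. \<forall>y\<in>b. c0 x y = code (d, f g (\<tau> (p x y)))"
          using A'(3)[THEN spec, of "\<lambda>m. code (d, f g (\<tau> m))"] by blast
        \<comment> \<open>Here \<open>c0 x y\<close> decodes to \<open>d\<close> and
          \<open>f g (\<tau> (p x y))\<close>, and \<open>c1 d y = g\<close> selects the right
          inverse \<open>e g\<close>. The value lies in \<open>Field r\<close>, so the default is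
          avoided.\<close>
        have "c x y = \<tau> (p x y)" if "x \<in> a" "y \<in> b" for x y
        proof -
          have "x \<in> Field r" "y \<in> Field r" "ord_less r x y"
            using that ab AB A'(1) \<open>B' \<subseteq> B\<close> unfolding set_below_def by blast+
          then have "p x y \<in> M" using p unfolding is_partition_def by blast
          moreover have "c1 d y = g" using ab(2) that(2) unfolding B'_def by blast
          moreover have "(\<tau> (p x y), g) \<in> r" using \<tau> \<open>p x y \<in> M\<close> by blast
          moreover from this have "\<tau> (p x y) \<in> Field r" by (rule FieldI1)
          ultimately show ?thesis
            using ab(4) that dec[OF d(1) fl] e[OF g] unfolding c_def by simp
        qed
        then show "\<exists>a\<in>A'. \<exists>b\<in>B. set_below r a b \<and> (\<forall>x\<in>a. \<forall>y\<in>b. c x y = \<tau> (p x y))"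
          using ab \<open>B' \<subseteq> B\<close> by blast
      qed
      moreover obtain X where "X \<in> F" "A' \<subseteq> X" using F_cof A'(1,2) by blast
      ultimately show ?thesis using works_mono by blast
    qed
    \<comment> \<open>Large-many \<open>g\<close> are distributed over at most \<open>lam\<close>
      members of \<open>F\<close>, so one \<open>X\<close>, chosen before any \<open>\<tau>\<close>,
      works for a large set of \<open>g\<close>.\<close>
    obtain X where X: "X \<in> F" "\<not> |{g \<in> Field r. works g X}| \<le>o lam"
      by (rule pigeonhole[where P = "\<lambda>X g. works g X", OF not_ordLeq_lam_Field F_le some_works])
    have "\<exists>a\<in>X. \<exists>b\<in>B. set_below r a b \<and> (\<forall>x\<in>a. \<forall>y\<in>b. c x y = \<tau> (p x y))"
      if \<tau>: "\<forall>m\<in>M. \<tau> m \<in> Field r" for \<tau>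
    proof -
      have "|\<tau> ` M| \<le>o lam" by (rule ordLeq_transitive[OF card_of_image M])
      moreover have "\<tau> ` M \<subseteq> Field r" using \<tau> by blast
      ultimately obtain t where t: "t \<in> Field r" "\<And>x. x \<in> \<tau> ` M \<Longrightarrow> (x, t) \<in> r"
        using bounded_if_ordLeq_lam by metis
      \<comment> \<open>A large set of \<open>g\<close> is unbounded, so some \<open>g\<close> for
        which \<open>X\<close> works lies above the bound \<open>t\<close> of the range of
        \<open>\<tau>\<close>.\<close>
      have "\<not> {g \<in> Field r. works g X} \<subseteq> {y. (y, t) \<in> r}"
        using X(2) card_under_ordLeq_lam[OF t(1)] ordLeq_lam_subset by blast
      then obtain g where "works g X" "(t, g) \<in> r" using t(1) r_total by blast
      moreover have "\<forall>m\<in>M. (\<tau> m, g) \<in> r" using t(2) r_trans[OF _ \<open>(t, g) \<in> r\<close>] by blast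
      ultimately show ?thesis unfolding works_def by simp
    qed
    then show "\<exists>A'\<subseteq>A. |A'| =o nu \<and> (\<forall>\<tau>. (\<forall>m\<in>M. \<tau> m \<in> Field r) \<longrightarrow>
        (\<exists>a\<in>A'. \<exists>b\<in>B. set_below r a b \<and> (\<forall>x\<in>a. \<forall>y\<in>b. c x y = \<tau> (p x y))))"
      using F_mem[OF X(1)] by (intro exI[of _ X]) simp
  qed
qed

end

theorem theorem3p3:
  fixes lam :: "'l rel" and r :: "'k rel" and nu :: "'n rel" and chi :: "'x rel"
    and M :: "'m set" and p :: "'k \<Rightarrow> 'k \<Rightarrow> 'm"
  assumes "Card_order lam" and "\<not> finite (Field lam)"
    and "Card_order r" and "r =o cardSuc lam"
    and "Card_order nu" and "nu \<le>o lam" and "|M| \<le>o lam"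
    and "cf_subsets_le lam nu lam"
    and "Card_order chi"
    and "is_partition r M p"
    and "pr1 r lam nu (Field lam) chi M p"
    and "pr1 r lam lam (Field r) chi {()} (\<lambda>_ _. ())"
  shows "pr1 r lam nu (Field r) chi M p"
proof -
  interpret card_successor lam r using assms(1-4) by unfold_locales
  show ?thesis using pr1_stretch_colors assms(7,8,10-12) by blast
qed

end
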